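(* There are ruled translating solitons in $\mathbb{E}_1^3$ that are not cylindrical. That is, there exist a nonzero vector $\vec v\in\mathbb{E}_1^3$ and a ruled surface $M$ which is a translating soliton with respect to $\vec v$ and is not a cylindrical surface.
   Context: $\mathbb{E}_1^3$ is $\mathbb{R}^3$ with coordinates $(x,y,z)$ and metric $\langle\,,\rangle=dx^2+dy^2-dz^2$. A (connected, smooth) surface $M$ is non-degenerate if its induced metric is non-degenerate. Let $N$ be a (local) unit normal field, $\epsilon=\langle N,N\rangle\in\{-1,1\}$, and $\sigma$ the second fundamental form, $\nabla^0_UV=\nabla_UV+\sigma(U,V)$. The mean curvature vector is $\vec H=\frac12\,\mathrm{trace}(\sigma)$ (trace with respect to the induced metric), and the mean curvature $H$ is defined by $\vec H=HN$. A translating soliton with respect to a nonzero vector $\vec v$ is a non-degenerate surface with $2H=\langle N,\vec v\rangle$ at every point. A ruled surface is parametrized by $X(s,t)=\gamma(s)+t\,w(s)$, $(s,t)\in I\times J$ with $I,J$ open intervals, where $\gamma$ is a smooth regular curve and $w$ is a smooth nowhere vanishing vector field along $\gamma$. A surface is cylindrical if it can be parametrized (locally) as a ruled surface all of whose rulings are parallel to a fixed direction; in particular planes are cylindrical. *)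

theory Defs
  imports "HOL-Analysis.Analysis"
begin

subsection \<open>Smooth maps between Euclidean spaces\<close>

primrec times_differentiable_on ::
  "nat \<Rightarrow> 'a::euclidean_space set \<Rightarrow> ('a \<Rightarrow> 'b::euclidean_space) \<Rightarrow> bool" where
  "times_differentiable_on 0 S f \<longleftrightarrow> continuous_on S f"
| "times_differentiable_on (Suc k) S f \<longleftrightarrow>
     (\<forall>x\<in>S. f differentiable at x) \<and>
     (\<forall>u. times_differentiable_on k S (\<lambda>x. frechet_derivative f (at x) u))"

text \<open>Only used for open \<open>S\<close>.\<close>

definition smooth_on ::
  "'a::euclidean_space set \<Rightarrow> ('a \<Rightarrow> 'b::euclidean_space) \<Rightarrow> bool" where
  "smooth_on S f \<longleftrightarrow> (\<forall>k. times_differentiable_on k S f)"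

definition diffeomorphism ::
  "'a::euclidean_space set \<Rightarrow> 'b::euclidean_space set \<Rightarrow> ('a \<Rightarrow> 'b) \<Rightarrow> bool" where
  "diffeomorphism S T f \<longleftrightarrow>
     smooth_on S f \<and> f ` S = T \<and>
     (\<exists>g. smooth_on T g \<and> (\<forall>x\<in>S. g (f x) = x))"

definition open_interval :: "real set \<Rightarrow> bool" where
  "open_interval I \<longleftrightarrow> open I \<and> is_interval I \<and> I \<noteq> {}"

subsection \<open>Surfaces in Lorentz-Minkowski space\<close>

definition mink :: "real^3 \<Rightarrow> real^3 \<Rightarrow> real" where
  "mink a b = a $ 1 * b $ 1 + a $ 2 * b $ 2 - a $ 3 * b $ 3"

definition parametrized_surface ::
  "(real \<times> real) set \<Rightarrow> (real \<times> real \<Rightarrow> real^3) \<Rightarrow> bool" where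
  "parametrized_surface U X \<longleftrightarrow>
     open U \<and> connected U \<and> U \<noteq> {} \<and> smooth_on U X \<and>
     (\<forall>p\<in>U. inj (frechet_derivative X (at p)))"

definition tangent_plane :: "(real \<times> real \<Rightarrow> real^3) \<Rightarrow> real \<times> real \<Rightarrow> (real^3) set" where
  "tangent_plane X p = range (frechet_derivative X (at p))"

definition induced_metric ::
  "(real \<times> real \<Rightarrow> real^3) \<Rightarrow> real \<times> real \<Rightarrow> real \<times> real \<Rightarrow> real \<times> real \<Rightarrow> real" where
  "induced_metric X p a b =
     mink (frechet_derivative X (at p) a) (frechet_derivative X (at p) b)"

definition nondegenerate_surface ::
  "(real \<times> real) set \<Rightarrow> (real \<times> real \<Rightarrow> real^3) \<Rightarrow> bool" where
  "nondegenerate_surface U X \<longleftrightarrow>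
     parametrized_surface U X \<and>
     (\<forall>p\<in>U. \<forall>a. (\<forall>b. induced_metric X p a b = 0) \<longrightarrow> a = 0)"

definition unit_normal :: "(real \<times> real \<Rightarrow> real^3) \<Rightarrow> real \<times> real \<Rightarrow> real^3 \<Rightarrow> bool" where
  "unit_normal X p N \<longleftrightarrow>
     (\<forall>\<tau>\<in>tangent_plane X p. mink N \<tau> = 0) \<and> mink N N \<in> {-1, 1}"

text \<open>For the tangent fields that are the images under \<open>dX\<close> of the constant fields \<open>a\<close> and \<open>b\<close>
  on the parameter domain, the flat covariant derivative of the second along the first is the
  iterated directional derivative of \<open>X\<close>. The second fundamental form is its component normal
  to the surface in the Gauss decomposition; existence and uniqueness of this component hold
  where the induced metric is non-degenerate.\<close>

definition second_fundamental_form ::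
  "(real \<times> real \<Rightarrow> real^3) \<Rightarrow> real \<times> real \<Rightarrow> real \<times> real \<Rightarrow> real \<times> real \<Rightarrow> real^3" where
  "second_fundamental_form X p a b =
     (THE n. (\<forall>\<tau>\<in>tangent_plane X p. mink n \<tau> = 0) \<and>
        frechet_derivative (\<lambda>q. frechet_derivative X (at q) b) (at p) a - n
          \<in> tangent_plane X p)"

text \<open>The trace of a vector-valued bilinear form \<open>B\<close> on the parameter plane with respect to a
  non-degenerate metric \<open>g\<close>: the contraction of \<open>B\<close> with the inverse of the Gram matrix of \<open>g\<close>
  in the standard basis.\<close>

definition metric_trace ::
  "(real \<times> real \<Rightarrow> real \<times> real \<Rightarrow> real) \<Rightarrow> (real \<times> real \<Rightarrow> real \<times> real \<Rightarrow> real^3) \<Rightarrow> real^3" where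
  "metric_trace g B =
     (let e1 = (1, 0); e2 = (0, 1) in
      (1 / (g e1 e1 * g e2 e2 - g e1 e2 * g e2 e1)) *\<^sub>R
        (g e2 e2 *\<^sub>R B e1 e1 - g e1 e2 *\<^sub>R B e1 e2 - g e2 e1 *\<^sub>R B e2 e1
          + g e1 e1 *\<^sub>R B e2 e2))"

definition mean_curvature_vector :: "(real \<times> real \<Rightarrow> real^3) \<Rightarrow> real \<times> real \<Rightarrow> real^3" where
  "mean_curvature_vector X p =
     (1 / 2) *\<^sub>R metric_trace (induced_metric X p) (second_fundamental_form X p)"

definition mean_curvature ::
  "(real \<times> real \<Rightarrow> real^3) \<Rightarrow> real \<times> real \<Rightarrow> real^3 \<Rightarrow> real" where
  "mean_curvature X p N = (THE H. mean_curvature_vector X p = H *\<^sub>R N)"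

text \<open>Replacing \<open>N\<close> by \<open>-N\<close> changes the sign of both sides of the soliton equation, so it does
  not matter that it is required for both unit normals at each point.\<close>

definition translating_soliton ::
  "real^3 \<Rightarrow> (real \<times> real) set \<Rightarrow> (real \<times> real \<Rightarrow> real^3) \<Rightarrow> bool" where
  "translating_soliton v U X \<longleftrightarrow>
     v \<noteq> 0 \<and> nondegenerate_surface U X \<and>
     (\<forall>p\<in>U. \<forall>N. unit_normal X p N \<longrightarrow> 2 * mean_curvature X p N = mink N v)"

subsection \<open>Ruled and cylindrical surfaces\<close>

definition ruled_map ::
  "(real \<Rightarrow> real^3) \<Rightarrow> (real \<Rightarrow> real^3) \<Rightarrow> real \<times> real \<Rightarrow> real^3" where
  "ruled_map \<gamma> w = (\<lambda>(s, t). \<gamma> s + t *\<^sub>R w s)"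

definition ruled_data ::
  "real set \<Rightarrow> real set \<Rightarrow> (real \<Rightarrow> real^3) \<Rightarrow> (real \<Rightarrow> real^3) \<Rightarrow> bool" where
  "ruled_data I J \<gamma> w \<longleftrightarrow>
     open_interval I \<and> open_interval J \<and>
     smooth_on I \<gamma> \<and> (\<forall>s\<in>I. vector_derivative \<gamma> (at s) \<noteq> 0) \<and>
     smooth_on I w \<and> (\<forall>s\<in>I. w s \<noteq> 0)"

definition ruled_surface :: "(real \<times> real) set \<Rightarrow> (real \<times> real \<Rightarrow> real^3) \<Rightarrow> bool" where
  "ruled_surface U X \<longleftrightarrow>
     parametrized_surface U X \<and>
     (\<exists>I J \<gamma> w. ruled_data I J \<gamma> w \<and> U = I \<times> J \<and> (\<forall>p\<in>U. X p = ruled_map \<gamma> w p))"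

text \<open>The direction \<open>d\<close> is fixed within each local reparametrization but may vary between them.
  This is weaker than asking for one common direction, so its negation is the stronger one.\<close>

definition cylindrical_surface :: "(real \<times> real) set \<Rightarrow> (real \<times> real \<Rightarrow> real^3) \<Rightarrow> bool" where
  "cylindrical_surface U X \<longleftrightarrow>
     parametrized_surface U X \<and>
     (\<forall>p\<in>U. \<exists>V I J \<gamma> w d \<phi>.
        open V \<and> p \<in> V \<and> V \<subseteq> U \<and>
        ruled_data I J \<gamma> w \<and> d \<noteq> 0 \<and> (\<forall>s\<in>I. w s \<in> span {d}) \<and>
        diffeomorphism (I \<times> J) V \<phi> \<and>
        (\<forall>q\<in>I \<times> J. X (\<phi> q) = ruled_map \<gamma> w q))"

end

theory Submission imports Defs begin

text \<open>
  Let \<open>b = (1, 0, 1)\<close> and \<open>c = (1, 0, -1)\<close>, which are null, and \<open>a = (0, 1, 0)\<close>, which is a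
  spacelike unit vector orthogonal to both. The example has rulings along \<open>w s = a + s b\<close>. These
  vectors are spacelike of length one although \<open>w' = b\<close> is null, so they turn while staying
  parallel to the degenerate plane \<open>b\<^sup>\<bottom>\<close>; nothing of the kind exists in Euclidean space.

  Sliding the base curve along the rulings, take \<open>\<gamma>' = p b + r c\<close>. Write \<open>W\<close> for the Gram
  determinant of \<open>\<gamma> + \<tau> w\<close>. Where \<open>W > 0\<close>, the soliton equation, multiplied by suitable powers
  of \<open>W\<close>, is a polynomial of degree two in \<open>\<tau>\<close>.
  Its leading coefficient is a multiple of \<open>r det (v, b, w)\<close> and vanishes when \<open>v = \<lambda> b\<close>. The two
  other coefficients give the equations \<open>r' = 4 \<lambda> r\<^sup>2\<close> and \<open>p' = 4 s r + 4 \<lambda> s\<^sup>2 r\<^sup>2\<close>. With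
  \<open>\<lambda> = -1/4\<close> they are solved for \<open>s > 0\<close> by \<open>r = 1/s\<close> and \<open>p = 3 s\<close>, that is, by
  \<open>\<gamma> = (3/2) s\<^sup>2 b + (ln s) c\<close>. Then \<open>W = 8 + 4 \<tau> / s\<close>, and the substitutions \<open>s = exp x\<close> and
  \<open>\<tau> = (u - 2) s\<close> turn the part \<open>W > 0\<close> of the surface into
  \<open>X (x, u) = (u - 1/2) exp (2 x) b + (u - 2) exp x a + x c\<close> with \<open>u > 0\<close>. This is the
  parametrization used below. The tangent planes are the orthogonal complements of an explicit
  timelike vector field \<open>n\<close> (\<open>tangent_plane_surf\<close>). Orthogonal projection to the line of \<open>n\<close>
  gives the second fundamental form, and the soliton equation is then a computation
  (\<open>mean_curvature_vector_surf\<close>, \<open>soliton_surf\<close>).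

  The surface is not cylindrical because a direction of parallel rulings lies in every tangent
  plane of an open part (\<open>cylindrical_direction_tangent\<close>), whereas the components of \<open>n\<close> are
  linearly independent functions on every open set (\<open>no_common_tangent_direction\<close>).
\<close>

section \<open>A space of exponential polynomials closed under derivatives\<close>

text \<open>The surface, its base curve and its rulings all have this form, with \<open>l\<close> and \<open>m\<close> the two coordinates of the plane, or the identity and zero on the line. The terms
  are chosen such that every directional derivative is again of this form.\<close>

definition quasi_poly ::
  "('a \<Rightarrow> real) \<Rightarrow> ('a \<Rightarrow> real) \<Rightarrow> 'b \<Rightarrow> 'b \<Rightarrow> 'b \<Rightarrow> 'b \<Rightarrow> 'b \<Rightarrow> 'b \<Rightarrow> 'a \<Rightarrow> 'b::real_vector" where
  "quasi_poly l m c0 c1 c2 c3 c4 c5 p =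
     c0 + l p *\<^sub>R c1 + (m p * (exp (l p))\<^sup>2) *\<^sub>R c2 + (exp (l p))\<^sup>2 *\<^sub>R c3
        + (m p * exp (l p)) *\<^sub>R c4 + exp (l p) *\<^sub>R c5"

lemma has_derivative_quasi_poly:
  fixes l m :: "'a::real_normed_vector \<Rightarrow> real"
    and c0 c1 c2 c3 c4 c5 :: "'b::real_normed_vector"
  assumes l: "bounded_linear l" and m: "bounded_linear m"
  shows "(quasi_poly l m c0 c1 c2 c3 c4 c5 has_derivative
     (\<lambda>u. quasi_poly l m (l u *\<^sub>R c1) 0 ((2 * l u) *\<^sub>R c2) (m u *\<^sub>R c2 + (2 * l u) *\<^sub>R c3)
        (l u *\<^sub>R c4) (m u *\<^sub>R c4 + l u *\<^sub>R c5) p)) (at p)"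
proof -
  have [derivative_intros]: "(l has_derivative l) (at p)" "(m has_derivative m) (at p)"
    using l m by (auto intro: bounded_linear_imp_has_derivative)
  show ?thesis
    unfolding quasi_poly_def
    by (rule derivative_eq_intros refl | simp add: fun_eq_iff algebra_simps power2_eq_square)+
qed

lemma frechet_derivative_quasi_poly:
  fixes l m :: "'a::real_normed_vector \<Rightarrow> real"
    and c0 c1 c2 c3 c4 c5 :: "'b::real_normed_vector"
  assumes "bounded_linear l" and "bounded_linear m"
  shows "frechet_derivative (quasi_poly l m c0 c1 c2 c3 c4 c5) (at p) u =
     quasi_poly l m (l u *\<^sub>R c1) 0 ((2 * l u) *\<^sub>R c2) (m u *\<^sub>R c2 + (2 * l u) *\<^sub>R c3)
        (l u *\<^sub>R c4) (m u *\<^sub>R c4 + l u *\<^sub>R c5) p"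
  by (rule fun_cong[OF frechet_derivative_at[OF has_derivative_quasi_poly[OF assms], symmetric]])

text \<open>A family of differentiable functions closed under directional derivatives consists of smooth
  functions: the induction on the order of differentiability needs no product or chain rule.\<close>

lemma smooth_on_quasi_poly:
  fixes l m :: "'a::euclidean_space \<Rightarrow> real"
    and c0 c1 c2 c3 c4 c5 :: "'b::euclidean_space"
  assumes "bounded_linear l" and "bounded_linear m"
  shows "smooth_on S (quasi_poly l m c0 c1 c2 c3 c4 c5)"
proof -
  note diff = has_derivative_quasi_poly[OF assms]
  have "times_differentiable_on k S (quasi_poly l m c0 c1 c2 c3 c4 c5)" for k
  proof (induction k arbitrary: c0 c1 c2 c3 c4 c5)
    case 0
    show ?case
      by (auto intro!: continuous_at_imp_continuous_on has_derivative_continuous diff)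
  next
    case (Suc k)
    have "quasi_poly l m c0 c1 c2 c3 c4 c5 differentiable at x" for x
      unfolding differentiable_def using diff by blast
    then show ?case
      using Suc.IH by (simp add: frechet_derivative_quasi_poly[OF assms])
  qed
  then show ?thesis by (simp add: smooth_on_def)
qed

section \<open>The surface\<close>

definition null_vec :: "real^3" where "null_vec = vector [1, 0, 1]"
definition space_vec :: "real^3" where "space_vec = vector [0, 1, 0]"
definition null_vec' :: "real^3" where "null_vec' = vector [1, 0, -1]"

lemmas frame_defs = null_vec_def space_vec_def null_vec'_def

text \<open>The curve \<open>u = 0\<close>. It bounds the surface without belonging to it; the induced metric of the
  extended surface degenerates there.\<close>

definition base_curve :: "real \<Rightarrow> real^3" where
  "base_curve = quasi_poly (\<lambda>x. x) (\<lambda>_. 0) 0 null_vec' 0 ((-1/2) *\<^sub>R null_vec) 0 ((-2) *\<^sub>R space_vec)"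

definition ruling :: "real \<Rightarrow> real^3" where
  "ruling = quasi_poly (\<lambda>x. x) (\<lambda>_. 0) 0 0 0 null_vec 0 space_vec"

definition surf :: "real \<times> real \<Rightarrow> real^3" where
  "surf = quasi_poly fst snd 0 null_vec' null_vec ((-1/2) *\<^sub>R null_vec) space_vec ((-2) *\<^sub>R space_vec)"

text \<open>The Lorentzian cross product of the two coordinate tangent vectors, divided by \<open>exp x\<close>.\<close>

definition normal_field :: "real \<times> real \<Rightarrow> real^3" where
  "normal_field = (\<lambda>(x, u).
     vector [1 - (u + 1) * (exp x)\<^sup>2, - 2 * exp x, - (u + 1) * (exp x)\<^sup>2 - 1])"

lemma surf_ruled: "surf p = ruled_map base_curve ruling p"
  by (cases p)
    (simp add: surf_def base_curve_def ruling_def ruled_map_def quasi_poly_def algebra_simps)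

lemma ruled_data_surf: "ruled_data UNIV {0<..} base_curve ruling"
proof -
  have "vector_derivative base_curve (at s) \<noteq> 0" for s
  proof -
    have "(base_curve has_vector_derivative
        (null_vec' - (exp s)\<^sup>2 *\<^sub>R null_vec - (2 * exp s) *\<^sub>R space_vec)) (at s)"
      unfolding has_vector_derivative_def base_curve_def
      by (rule has_derivative_eq_rhs, rule has_derivative_quasi_poly)
        (auto simp: quasi_poly_def fun_eq_iff algebra_simps)
    then show ?thesis
      by (simp add: vector_derivative_at frame_defs vec_eq_iff forall_3)
  qed
  moreover have "ruling s \<noteq> 0" for s
    by (simp add: ruling_def quasi_poly_def frame_defs vec_eq_iff forall_3)
  moreover have "smooth_on UNIV base_curve" "smooth_on UNIV ruling"
    unfolding base_curve_def ruling_def by (simp_all add: smooth_on_quasi_poly)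
  ultimately show ?thesis
    by (auto simp: ruled_data_def open_interval_def is_interval_univ is_interval_oi)
qed

lemma surf_differentiable: "surf differentiable at p"
  unfolding surf_def differentiable_def
  using has_derivative_quasi_poly[OF bounded_linear_fst bounded_linear_snd] by blast

lemma surf_derivative_quasi_poly:
  "(\<lambda>q. frechet_derivative surf (at q) (h, k)) =
     quasi_poly fst snd (h *\<^sub>R null_vec') 0 ((2 * h) *\<^sub>R null_vec) ((k - h) *\<^sub>R null_vec)
       (h *\<^sub>R space_vec) ((k - 2 * h) *\<^sub>R space_vec)"
  unfolding surf_def frechet_derivative_quasi_poly[OF bounded_linear_fst bounded_linear_snd]
  by (simp add: fun_eq_iff quasi_poly_def scaleR_left_diff_distrib)

lemma surf_derivative:
  "frechet_derivative surf (at (x, u)) (h, k) =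
     vector [h * ((2 * u - 1) * (exp x)\<^sup>2 + 1) + k * (exp x)\<^sup>2,
             h * (u - 2) * exp x + k * exp x,
             h * ((2 * u - 1) * (exp x)\<^sup>2 - 1) + k * (exp x)\<^sup>2]"
  unfolding fun_cong[OF surf_derivative_quasi_poly] quasi_poly_def frame_defs
  by (simp add: vec_eq_iff forall_3) (simp add: algebra_simps)

lemma surf_second_derivative:
  "frechet_derivative (\<lambda>q. frechet_derivative surf (at q) (h', k')) (at (x, u)) (h, k) =
     vector [(2 * h * h' * (2 * u - 1) + 2 * (h * k' + h' * k)) * (exp x)\<^sup>2,
             (h * h' * (u - 2) + (h * k' + h' * k)) * exp x,
             (2 * h * h' * (2 * u - 1) + 2 * (h * k' + h' * k)) * (exp x)\<^sup>2]"
  unfolding surf_derivative_quasi_poly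
    frechet_derivative_quasi_poly[OF bounded_linear_fst bounded_linear_snd]
  unfolding quasi_poly_def frame_defs
  by (simp add: vec_eq_iff forall_3) (simp add: algebra_simps)

section \<open>Normal vectors and the second fundamental form\<close>

lemma mink_3: "mink (vector [a1, a2, a3]) (vector [b1, b2, b3]) = a1 * b1 + a2 * b2 - a3 * b3"
  by (simp add: mink_def)

lemma mink_scale: "mink (c *\<^sub>R a) b = c * mink a b" "mink a (c *\<^sub>R b) = c * mink a b"
  by (simp_all add: mink_def algebra_simps)

lemma mink_add_right: "mink a (b + b') = mink a b + mink a b'"
  by (simp add: mink_def algebra_simps)

lemma mink_diff: "mink (a - a') b = mink a b - mink a' b" "mink a (b - b') = mink a b - mink a b'"
  by (simp_all add: mink_def algebra_simps)

lemma normal_field_eq: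
  "normal_field (x, u) =
     vector [1 - (u + 1) * (exp x)\<^sup>2, - 2 * exp x, - (u + 1) * (exp x)\<^sup>2 - 1]"
  by (simp add: normal_field_def)

lemma normal_field_square: "mink (normal_field (x, u)) (normal_field (x, u)) = - 4 * u * (exp x)\<^sup>2"
  unfolding normal_field_eq mink_3 by algebra

text \<open>A tangent vector \<open>dX (h, k)\<close> is recovered from its coordinates: the first minus the third
  gives \<open>h\<close> and the second then gives \<open>k\<close>; what remains to be matched is a single
  linear equation, orthogonality to \<open>n\<close>.\<close>

lemma tangent_plane_surf:
  "tangent_plane surf (x, u) = {y. mink (normal_field (x, u)) y = 0}"
proof (intro subset_antisym subsetI CollectI)
  fix y assume "y \<in> tangent_plane surf (x, u)"
  then obtain h k where y: "y = frechet_derivative surf (at (x, u)) (h, k)"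
    by (auto simp: tangent_plane_def)
  show "mink (normal_field (x, u)) y = 0"
    unfolding y surf_derivative normal_field_eq mink_3 by algebra
next
  fix y assume "y \<in> {y. mink (normal_field (x, u)) y = 0}"
  moreover obtain e where e: "exp x = e" "e > 0" by simp
  ultimately have 0: "(1 - (u + 1) * e\<^sup>2) * y$1 + (- 2 * e) * y$2 - (- (u + 1) * e\<^sup>2 - 1) * y$3 = 0"
    by (simp only: normal_field_eq mink_def vector_3 mem_Collect_eq)
  define h where "h = (y$1 - y$3) / 2"
  define k where "k = y$2 / e - h * (u - 2)"
  have y2: "y$2 = h * (u - 2) * e + k * e"
    using e by (simp add: k_def field_simps)
  have y13: "y$1 = y$3 + 2 * h" by (simp add: h_def field_simps)
  have "2 * (y$3 - (h * ((2 * u - 1) * e\<^sup>2 - 1) + k * e\<^sup>2)) = 0"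
    using 0 unfolding y13 y2 by algebra
  then have y3: "y$3 = h * ((2 * u - 1) * e\<^sup>2 - 1) + k * e\<^sup>2"
    by (simp only: mult_eq_0_iff) simp
  have y1: "y$1 = h * ((2 * u - 1) * e\<^sup>2 + 1) + k * e\<^sup>2"
    unfolding y13 y3 by algebra
  have "y = frechet_derivative surf (at (x, u)) (h, k)"
    unfolding surf_derivative e(1) by (simp only: vec_eq_iff forall_3 vector_3 y1 y2 y3 simp_thms)
  then show "y \<in> tangent_plane surf (x, u)"
    by (simp add: tangent_plane_def)
qed

lemma mink_nondegenerate:
  assumes "\<And>y. mink z y = 0"
  shows "z = 0"
  using assms[of "axis 1 1"] assms[of "axis 2 1"] assms[of "axis 3 1"]
  by (simp add: mink_def axis_def vec_eq_iff forall_3)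

text \<open>As \<open>n\<close> is not null, space is the direct sum of the line of \<open>n\<close> and the plane orthogonal to it,
  so a vector orthogonal to both summands is zero. This applies to \<open>z\<close> minus its projection to the
  line.\<close>

lemma normal_line:
  assumes n: "mink n n \<noteq> 0" and z: "\<And>y. mink n y = 0 \<Longrightarrow> mink z y = 0"
  shows "z = (mink n z / mink n n) *\<^sub>R n"
proof -
  define r where "r = z - (mink n z / mink n n) *\<^sub>R n"
  have nr: "mink n r = 0"
    using n by (simp add: r_def mink_diff mink_scale)
  have sym: "mink a b = mink b a" for a b by (simp add: mink_def mult.commute)
  have "mink r y = 0" for y
  proof -
    define t where "t = y - (mink n y / mink n n) *\<^sub>R n"
    have nt: "mink n t = 0"
      using n by (simp add: t_def mink_diff mink_scale)
    then have "mink r t = 0"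
      by (simp add: r_def mink_diff mink_scale z)
    moreover have "y = t + (mink n y / mink n n) *\<^sub>R n"
      by (simp add: t_def)
    ultimately show ?thesis
      by (metis mink_add_right mink_scale(2) nr sym add.right_neutral mult_zero_right)
  qed
  then have "r = 0" by (rule mink_nondegenerate)
  then show ?thesis by (simp add: r_def)
qed

text \<open>Both the tangent plane and its orthogonal complement are determined by \<open>n\<close>, so the Gauss
  decomposition is the orthogonal projection along \<open>n\<close>.\<close>

lemma second_fundamental_form_eq:
  fixes X p a b n
  defines "A \<equiv> frechet_derivative (\<lambda>q. frechet_derivative X (at q) b) (at p) a"
  assumes n: "mink n n \<noteq> 0" and tan: "tangent_plane X p = {y. mink n y = 0}"
  shows "second_fundamental_form X p a b = (mink n A / mink n n) *\<^sub>R n"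
  unfolding second_fundamental_form_def A_def[symmetric] tan
proof (rule the_equality)
  show "(\<forall>\<tau>\<in>{y. mink n y = 0}. mink ((mink n A / mink n n) *\<^sub>R n) \<tau> = 0) \<and>
    A - (mink n A / mink n n) *\<^sub>R n \<in> {y. mink n y = 0}"
    using n by (simp add: mink_diff mink_scale)
next
  fix z assume z: "(\<forall>\<tau>\<in>{y. mink n y = 0}. mink z \<tau> = 0) \<and> A - z \<in> {y. mink n y = 0}"
  then have "z = (mink n z / mink n n) *\<^sub>R n"
    by (intro normal_line n) auto
  moreover have "mink n z = mink n A"
    using z by (simp add: mink_diff)
  ultimately show "z = (mink n A / mink n n) *\<^sub>R n" by simp
qed

section \<open>The soliton equation\<close>

lemma inj_surf_derivative: "inj (frechet_derivative surf (at p))"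
proof -
  obtain x u where p: "p = (x, u)" by (cases p)
  have "linear (frechet_derivative surf (at p))"
    by (rule linear_frechet_derivative[OF surf_differentiable])
  moreover have "a = 0" if 0: "frechet_derivative surf (at p) a = 0" for a
  proof -
    obtain h k where a: "a = (h, k)" by (cases a)
    let ?y = "frechet_derivative surf (at (x, u)) (h, k)"
    have "?y $ 1 - ?y $ 3 = 2 * h" "?y $ 2 = (h * (u - 2) + k) * exp x"
      unfolding surf_derivative vector_3 by algebra+
    then show ?thesis using 0 by (auto simp: p a zero_prod_def)
  qed
  ultimately show ?thesis by (simp add: linear_injective_0)
qed

lemma parametrized_surf: "parametrized_surface (UNIV \<times> {0<..}) surf"
  unfolding parametrized_surface_def
  using inj_surf_derivative smooth_on_quasi_poly[OF bounded_linear_fst bounded_linear_snd]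
  by (auto simp: surf_def open_Times intro!: connected_Times)

lemma normal_field_nonnull:
  assumes "u > 0"
  shows "mink (normal_field (x, u)) (normal_field (x, u)) \<noteq> 0"
  using assms by (simp add: normal_field_square)

text \<open>A vector in the radical of the induced metric is both tangent and normal, and the normal line
  meets the tangent plane only in zero because \<open>n\<close> is not null.\<close>

lemma nondegenerate_surf: "nondegenerate_surface (UNIV \<times> {0<..}) surf"
  unfolding nondegenerate_surface_def
proof (intro conjI parametrized_surf ballI allI impI)
  fix p :: "real \<times> real" and a
  assume "p \<in> UNIV \<times> {0<..}" and a: "\<forall>b. induced_metric surf p a b = 0"
  then obtain x u where p: "p = (x, u)" "u > 0" by auto
  define n where "n = normal_field (x, u)"
  define y where "y = frechet_derivative surf (at p) a"
  have tan: "tangent_plane surf p = {y. mink n y = 0}"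
    by (simp add: p n_def tangent_plane_surf)
  have "y = (mink n y / mink n n) *\<^sub>R n"
  proof (rule normal_line)
    show "mink n n \<noteq> 0" using p by (simp add: n_def normal_field_nonnull)
    show "mink y z = 0" if "mink n z = 0" for z
    proof -
      have "z \<in> tangent_plane surf p" using that tan by simp
      then show ?thesis using a by (auto simp: tangent_plane_def induced_metric_def y_def)
    qed
  qed
  moreover have "mink n y = 0"
    using tan by (auto simp: tangent_plane_def y_def)
  ultimately have "frechet_derivative surf (at p) a = 0" by (simp add: y_def)
  then show "a = 0"
    using linear_injective_0[OF linear_frechet_derivative[OF surf_differentiable]]
      inj_surf_derivative by blast
qed

lemma mean_curvature_vector_surf:
  assumes u: "u > 0"
  shows "mean_curvature_vector surf (x, u) = (-1 / (16 * u * (exp x)\<^sup>2)) *\<^sub>R normal_field (x, u)"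
proof -
  obtain e where e: "exp x = e" "e > 0" by simp
  define n where "n = normal_field (x, u)"
  have n2: "mink n n = - 4 * u * e\<^sup>2"
    by (simp add: n_def normal_field_square e)
  have n_eq: "n = vector [1 - (u + 1) * e\<^sup>2, - 2 * e, - (u + 1) * e\<^sup>2 - 1]"
    by (simp add: n_def normal_field_eq e)
  have sff: "second_fundamental_form surf (x, u) (h, k) (h', k') =
      (- ((6 * u * (h * h') + 2 * (h * k' + h' * k)) / (4 * u))) *\<^sub>R n" for h k h' k'
  proof -
    have "mink n (frechet_derivative (\<lambda>q. frechet_derivative surf (at q) (h', k')) (at (x, u)) (h, k)) =
        (6 * u * (h * h') + 2 * (h * k' + h' * k)) * e\<^sup>2"
      unfolding surf_second_derivative n_eq mink_3 e by algebra
    moreover have "tangent_plane surf (x, u) = {y. mink n y = 0}"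
      by (simp add: n_def tangent_plane_surf)
    moreover have "mink n n \<noteq> 0" using n2 u e by simp
    ultimately show ?thesis
      using u e by (subst second_fundamental_form_eq[where n = n]) (simp_all add: n2 divide_simps)
  qed
  have E: "induced_metric surf (x, u) (1, 0) (1, 0) = (u\<^sup>2 + 4 * u) * e\<^sup>2"
    and F: "induced_metric surf (x, u) (1, 0) (0, 1) = u * e\<^sup>2"
    and F': "induced_metric surf (x, u) (0, 1) (1, 0) = u * e\<^sup>2"
    and G: "induced_metric surf (x, u) (0, 1) (0, 1) = e\<^sup>2"
    unfolding induced_metric_def surf_derivative mink_3 e by algebra+
  \<comment> \<open>The Gram determinant: \<open>u > 0\<close> is exactly the condition that the surface is spacelike.\<close>
  have W: "(u\<^sup>2 + 4 * u) * e\<^sup>2 * e\<^sup>2 - u * e\<^sup>2 * (u * e\<^sup>2) = 4 * u * e\<^sup>2 * e\<^sup>2"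
    by algebra
  have B: "second_fundamental_form surf (x, u) (1, 0) (1, 0) = (- 3 / 2) *\<^sub>R n"
       "second_fundamental_form surf (x, u) (1, 0) (0, 1) = (- 1 / (2 * u)) *\<^sub>R n"
       "second_fundamental_form surf (x, u) (0, 1) (1, 0) = (- 1 / (2 * u)) *\<^sub>R n"
       "second_fundamental_form surf (x, u) (0, 1) (0, 1) = 0"
    unfolding sff using u by (simp_all add: divide_simps)
  have "e\<^sup>2 *\<^sub>R (- 3 / 2) *\<^sub>R n - (u * e\<^sup>2) *\<^sub>R (- 1 / (2 * u)) *\<^sub>R n
      - (u * e\<^sup>2) *\<^sub>R (- 1 / (2 * u)) *\<^sub>R n + ((u\<^sup>2 + 4 * u) * e\<^sup>2) *\<^sub>R 0 = (- e\<^sup>2 / 2) *\<^sub>R n"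
    unfolding scaleR_scaleR scaleR_zero_right add_0_right scaleR_left_diff_distrib[symmetric]
    by (rule arg_cong[where f = "\<lambda>r. r *\<^sub>R n"]) (use u in \<open>simp add: field_simps\<close>)
  then have "metric_trace (induced_metric surf (x, u)) (second_fundamental_form surf (x, u)) =
      (1 / (4 * u * e\<^sup>2 * e\<^sup>2)) *\<^sub>R ((- e\<^sup>2 / 2) *\<^sub>R n)"
    unfolding metric_trace_def Let_def E F F' G W B by (simp only:)
  then show ?thesis
    unfolding mean_curvature_vector_def e n_def[symmetric]
    using u e by (simp add: field_simps)
qed

text \<open>A unit normal is \<open>N = c n\<close> with \<open>4 u c\<^sup>2 exp (2 x) = 1\<close>. Hence the mean curvature vector
  is \<open>- (c / 4) N\<close>, while \<open>n\<close> has the constant product 2 with \<open>b\<close>.\<close>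

lemma soliton_surf: "translating_soliton ((-1/4) *\<^sub>R null_vec) (UNIV \<times> {0<..}) surf"
  unfolding translating_soliton_def
proof (intro conjI nondegenerate_surf ballI allI impI)
  show "(-1/4) *\<^sub>R null_vec \<noteq> 0"
    by (simp add: null_vec_def vec_eq_iff forall_3)
next
  fix p :: "real \<times> real" and N
  assume "p \<in> UNIV \<times> {0<..}" and N: "unit_normal surf p N"
  then obtain x u where p: "p = (x, u)" and u: "u > 0" by auto
  obtain e where e: "exp x = e" "e > 0" by simp
  define n where "n = normal_field (x, u)"
  have n2: "mink n n = - 4 * u * e\<^sup>2"
    by (simp add: n_def normal_field_square e)
  define c where "c = mink n N / mink n n"
  have Nc: "N = c *\<^sub>R n"
    unfolding c_def
  proof (rule normal_line)
    show "mink n n \<noteq> 0" using n2 u e by simp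
    show "mink N y = 0" if "mink n y = 0" for y
      using N that unfolding unit_normal_def p tangent_plane_surf n_def by simp
  qed
  \<comment> \<open>The sign in \<open>mink N N \<in> {-1, 1}\<close> must be negative because \<open>n\<close> is timelike.\<close>
  have cc: "c\<^sup>2 * (4 * u * e\<^sup>2) = 1"
  proof -
    have "mink N N = - (c\<^sup>2 * (4 * u * e\<^sup>2))"
      by (simp add: Nc mink_scale n2 power2_eq_square)
    moreover have "c\<^sup>2 * (4 * u * e\<^sup>2) \<noteq> -1"
      using u by (smt (verit) mult_nonneg_nonneg zero_le_power2)
    moreover have "mink N N \<in> {-1, 1}" using N by (simp add: unit_normal_def)
    ultimately show ?thesis by auto
  qed
  have "N \<noteq> 0" using N by (auto simp: unit_normal_def mink_def)
  have "-1 / (16 * u * e\<^sup>2) = (- c / 4) * c"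
    using cc u e by (simp add: field_simps power2_eq_square)
  then have H: "mean_curvature_vector surf p = (- c / 4) *\<^sub>R N"
    using mean_curvature_vector_surf[OF u, of x]
    by (simp add: p e Nc n_def)
  have "mean_curvature surf p N = - c / 4"
    unfolding mean_curvature_def H
    by (rule the_equality) (use \<open>N \<noteq> 0\<close> in \<open>auto simp del: scaleR_minus_left\<close>)
  moreover have "mink n null_vec = 2"
    unfolding n_def normal_field_eq null_vec_def mink_3 by (simp add: algebra_simps)
  ultimately show "2 * mean_curvature surf p N = mink N ((-1/4) *\<^sub>R null_vec)"
    unfolding mink_scale by (simp add: Nc mink_scale(1))
qed

section \<open>The surface is not cylindrical\<close>

text \<open>In the cylindrical parametrization the ruling through \<open>q\<close> is a curve on the surface, and its
  velocity is a nonzero multiple of \<open>d\<close>.\<close>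

lemma cylindrical_direction_tangent:
  assumes X: "\<And>q. q \<in> V \<Longrightarrow> X differentiable at q"
    and ruled: "ruled_data I J \<gamma> w" and d: "\<forall>s\<in>I. w s \<in> span {d}"
    and \<phi>: "diffeomorphism (I \<times> J) V \<phi>"
    and eq: "\<forall>q\<in>I \<times> J. X (\<phi> q) = ruled_map \<gamma> w q"
    and q: "q \<in> V"
  shows "d \<in> tangent_plane X q"
proof -
  from \<phi> q obtain s t where st: "s \<in> I" "t \<in> J" "q = \<phi> (s, t)"
    by (auto simp: diffeomorphism_def)
  have "times_differentiable_on (Suc 0) (I \<times> J) \<phi>"
    using \<phi> unfolding diffeomorphism_def smooth_on_def by blast
  then have \<phi>': "(\<phi> has_derivative frechet_derivative \<phi> (at (s, t))) (at (s, t))"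
    using st by (simp add: frechet_derivative_works)
  have X': "(X has_derivative frechet_derivative X (at q)) (at (\<phi> (s, t)))"
    using X[OF q] st by (simp add: frechet_derivative_works)
  have "((\<lambda>\<tau>. (s, \<tau>)) has_derivative (\<lambda>h. (0, h))) (at t)"
    by (auto intro!: derivative_eq_intros)
  from has_derivative_compose[OF has_derivative_compose[OF this \<phi>'] X']
  have 1: "((\<lambda>\<tau>. X (\<phi> (s, \<tau>))) has_derivative
      (\<lambda>h. frechet_derivative X (at q) (frechet_derivative \<phi> (at (s, t)) (0, h)))) (at t)" .
  have "((\<lambda>\<tau>. \<gamma> s + \<tau> *\<^sub>R w s) has_derivative (\<lambda>h. h *\<^sub>R w s)) (at t)"
    by (auto intro!: derivative_eq_intros)
  then have 2: "((\<lambda>\<tau>. X (\<phi> (s, \<tau>))) has_derivative (\<lambda>h. h *\<^sub>R w s)) (at t)"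
    by (rule has_derivative_transform_within_open[where s = J])
      (use ruled st eq in \<open>auto simp: ruled_data_def open_interval_def ruled_map_def\<close>)
  define a where "a = frechet_derivative \<phi> (at (s, t)) (0, 1)"
  have w: "w s = frechet_derivative X (at q) a"
    using fun_cong[OF has_derivative_unique[OF 2 1], of 1] by (simp add: a_def)
  obtain k where k: "w s = k *\<^sub>R d"
    using d st by (auto simp: span_singleton)
  have "k \<noteq> 0" using k ruled st by (auto simp: ruled_data_def)
  then have "d = (1 / k) *\<^sub>R w s" by (simp add: k)
  also have "\<dots> = frechet_derivative X (at q) ((1 / k) *\<^sub>R a)"
    unfolding w by (rule linear_cmul[OF linear_frechet_derivative[OF X[OF q]], symmetric])
  finally show ?thesis by (auto simp: tangent_plane_def)
qed

text \<open>Orthogonality to \<open>n\<close> reads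
  \<open>(d\<^sub>1 + d\<^sub>3) - 2 exp x d\<^sub>2 - (u + 1) exp (2 x) (d\<^sub>1 - d\<^sub>3) = 0\<close>. Varying \<open>u\<close> alone
  isolates \<open>d\<^sub>1 - d\<^sub>3\<close>, and then varying \<open>x\<close> isolates \<open>d\<^sub>2\<close>.\<close>

lemma no_common_tangent_direction:
  assumes "open V" "(x, u) \<in> V" and d: "\<And>q. q \<in> V \<Longrightarrow> d \<in> tangent_plane surf q"
  shows "d = 0"
proof -
  obtain A B where AB: "open A" "open B" "(x, u) \<in> A \<times> B" "A \<times> B \<subseteq> V"
    by (rule open_prod_elim[OF assms(1,2)])
  then have AB: "open A" "open B" "x \<in> A" "u \<in> B" "A \<times> B \<subseteq> V"
    by simp_all
  have other: "\<exists>y\<in>S. y \<noteq> z" if S: "open S" "z \<in> S" for S and z :: real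
  proof (rule ccontr)
    assume "\<not> ?thesis"
    then have "S = {z}" using S by blast
    then show False using S not_open_singleton[of z] by simp
  qed
  obtain x' where x': "x' \<in> A" "x' \<noteq> x" using other[OF AB(1,3)] by blast
  obtain u' where u': "u' \<in> B" "u' \<noteq> u" using other[OF AB(2,4)] by blast
  have eq: "(d$1 + d$3) - 2 * exp y * d$2 - (r + 1) * (exp y)\<^sup>2 * (d$1 - d$3) = 0"
    if "y \<in> A" "r \<in> B" for y r
  proof -
    have "d \<in> tangent_plane surf (y, r)" using d AB that by auto
    then have "mink (normal_field (y, r)) d = 0" by (simp add: tangent_plane_surf)
    then show ?thesis unfolding normal_field_eq mink_def vector_3 by algebra
  qed
  have "(u' - u) * (exp x)\<^sup>2 * (d$1 - d$3) = 0"
    using eq[OF AB(3,4)] eq[OF AB(3) u'(1)] by algebra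
  then have 13: "d$1 = d$3" using u' by simp
  have "2 * (exp x' - exp x) * d$2 = 0"
    using eq[OF AB(3,4)] eq[OF x'(1) AB(4)] unfolding 13 by algebra
  then have 2: "d$2 = 0" using x' by simp
  have "d$3 = 0" using eq[OF AB(3,4)] 13 2 by simp
  then show ?thesis using 13 2 by (simp add: vec_eq_iff forall_3)
qed

theorem mainTheorem7:
  "\<exists>(v :: real^3) (U :: (real \<times> real) set) (X :: real \<times> real \<Rightarrow> real^3).
     v \<noteq> 0 \<and> ruled_surface U X \<and> translating_soliton v U X \<and> \<not> cylindrical_surface U X"
proof (intro exI conjI)
  show "(-1/4) *\<^sub>R null_vec \<noteq> 0"
    using soliton_surf by (simp add: translating_soliton_def)
  show "ruled_surface (UNIV \<times> {0<..}) surf"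
    unfolding ruled_surface_def using parametrized_surf ruled_data_surf surf_ruled by blast
  show "translating_soliton ((-1/4) *\<^sub>R null_vec) (UNIV \<times> {0<..}) surf"
    by (rule soliton_surf)
  show "\<not> cylindrical_surface (UNIV \<times> {0<..}) surf"
  proof
    assume "cylindrical_surface (UNIV \<times> {0<..}) surf"
    moreover have "(0, 1) \<in> UNIV \<times> {0::real<..}" by simp
    ultimately obtain V I J \<gamma> w d \<phi> where
      V: "open V" "(0, 1) \<in> V" and d: "d \<noteq> 0" "ruled_data I J \<gamma> w" "\<forall>s\<in>I. w s \<in> span {d}"
        "diffeomorphism (I \<times> J) V \<phi>" "\<forall>q\<in>I \<times> J. surf (\<phi> q) = ruled_map \<gamma> w q"
      unfolding cylindrical_surface_def by blast
    have "d \<in> tangent_plane surf q" if "q \<in> V" for q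
      using cylindrical_direction_tangent[OF surf_differentiable d(2-5) that] .
    then have "d = 0" by (rule no_common_tangent_direction[OF V])
    with d(1) show False by simp
  qed
qed

end
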